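(* Let $m\in\mathbb{N}$ and $M_k\ge 0$ for $k=0,1,\ldots,m-1$. Let $F(z)=\sum_{k=0}^{m-1}|z|^{2k} f_k(z)$ be a reduced poly-analytic function of order $m$ in the unit disk $\mathbb{D}$, where all the $f_k$ are holomorphic in $\mathbb{D}$, satisfying $F_z(0)=1$, $f_k(0)=0$ for $k\in\{0,1,\ldots,m-1\}$, and $f_k'(0)=1$ for $k=1,2,\ldots,m-1$. If $|f_k(z)|\le M_k$ for all $k\in\{0,1,\ldots,m-1\}$ and all $z\in\mathbb{D}$, then $M_k\ge 1$ for all $k\in\{0,1,\ldots,m-1\}$, $F$ is univalent in the disk $\mathbb{D}_{r_7}$, and $F(\mathbb{D}_{r_7})$ contains the schlicht disk $\mathbb{D}_{r_8}$, where $r_7$ is the unique root in $(0,1)$ of the equation $$1-\sum_{k=0}^{m-1}\left(M_k-\frac{1}{M_k}\right)\frac{\bigl(2k(1-r)+(2-r)\bigr)r^{2k+1}}{(1-r)^2}-\sum_{k=1}^{m-1}(2k+1)r^{2k}=0$$ and $$r_8=r_7-\frac{r_7(r_7^2-r_7^{2m})}{1-r_7^2}-\sum_{k=0}^{m-1}\left(M_k-\frac{1}{M_k}\right)\frac{r_7^{2k+2}}{1-r_7}.$$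
   Context: $\mathbb{D}_r=\{z\in\mathbb{C}:|z|<r\}$ and $\mathbb{D}=\mathbb{D}_1$; $\mathbb{N}=\{1,2,\ldots\}$. A reduced poly-analytic function of order $m$ in a domain $\Omega$ is a function of the form $F(z)=\sum_{k=0}^{m-1}|z|^{2k} f_k(z)$ with all $f_k$ analytic in $\Omega$. $F_z$ and $F_{\overline z}$ denote the Wirtinger derivatives $\frac12(F_x-iF_y)$ and $\frac12(F_x+iF_y)$. Univalent means injective. A schlicht disk in the image of $F$ is a disk that is the univalent image under $F$ of some region in the domain. Empty sums are $0$.
   Formalization: The existence and uniqueness of the root r_7 is asserted except when m = 1 and M_0 = 1; in that case F(z) = z and the equation reads 1 = 0, so r_7 and r_8 do not exist. *)

theory Defs
  imports "HOL-Complex_Analysis.Complex_Analysis"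
begin

text \<open>Partial derivatives of a function of \<open>z = x + \<i> y\<close>. They are meaningful only
  where the respective partial derivative exists.\<close>

definition partial_x :: "(complex \<Rightarrow> complex) \<Rightarrow> complex \<Rightarrow> complex" where
  "partial_x F z = vector_derivative (\<lambda>t::real. F (z + of_real t)) (at 0)"

definition partial_y :: "(complex \<Rightarrow> complex) \<Rightarrow> complex \<Rightarrow> complex" where
  "partial_y F z = vector_derivative (\<lambda>t::real. F (z + \<i> * of_real t)) (at 0)"

definition wirtinger_z :: "(complex \<Rightarrow> complex) \<Rightarrow> complex \<Rightarrow> complex" where
  "wirtinger_z F z = (partial_x F z - \<i> * partial_y F z) / 2"

text \<open>A genuine disk (\<open>0 < \<rho>\<close>) that is the univalent image under \<open>F\<close> of some region
  (open and connected set) contained in \<open>S\<close>; in particular the disk is contained in \<open>F ` S\<close>.\<close>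

definition contains_schlicht_disk ::
    "(complex \<Rightarrow> complex) \<Rightarrow> complex set \<Rightarrow> complex \<Rightarrow> real \<Rightarrow> bool" where
  "contains_schlicht_disk F S w \<rho> \<longleftrightarrow>
     0 < \<rho> \<and> (\<exists>U. U \<subseteq> S \<and> open U \<and> connected U \<and> inj_on F U \<and> F ` U = ball w \<rho>)"

text \<open>Left-hand side of the equation that determines the radius of univalence.\<close>

definition univalence_fun :: "nat \<Rightarrow> (nat \<Rightarrow> real) \<Rightarrow> real \<Rightarrow> real" where
  "univalence_fun m M r =
     1 - (\<Sum>k<m. (M k - 1 / M k) *
            (((2 * real k * (1 - r) + (2 - r)) * r ^ (2 * k + 1)) / (1 - r)\<^sup>2))
       - (\<Sum>k=1..<m. (2 * real k + 1) * r ^ (2 * k))"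

definition covering_radius :: "nat \<Rightarrow> (nat \<Rightarrow> real) \<Rightarrow> real \<Rightarrow> real" where
  "covering_radius m M r =
     r - r * (r\<^sup>2 - r ^ (2 * m)) / (1 - r\<^sup>2)
       - (\<Sum>k<m. (M k - 1 / M k) * (r ^ (2 * k + 2) / (1 - r)))"

end

theory Submission
  imports Defs
begin

text \<open>
  For a holomorphic function bounded by \<open>M\<close> on the unit disk with \<open>f 0 = 0\<close> and \<open>f' 0 = 1\<close>, all
  Taylor coefficients of order at least 2 are bounded by \<open>M - 1 / M\<close>: averaging \<open>f z / z\<close> over
  roots of unity moves any coefficient to first order, where the Schwarz-Pick inequality applies.
  A monomial \<open>\<bar>z\<bar>\<^sup>2\<^sup>k z\<^sup>n\<close> is a product of \<open>2 k + n\<close> factors and hence Lipschitz with constant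
  \<open>(2 k + n) \<rho>\<^sup>2\<^sup>k\<^sup>+\<^sup>n\<^sup>-\<^sup>1\<close> on the disk of radius \<open>\<rho>\<close>. Summing up, \<open>F z - z\<close> has Lipschitz constant
  \<open>1 - univalence_fun m M \<rho>\<close>, which is below 1 for \<open>\<rho> < r\<^sub>7\<close>. The same expansion bounds \<open>F\<close> on the
  circle of radius \<open>r\<^sub>7\<close> from below by the covering radius, and invariance of domain does the rest.
\<close>

section \<open>Taylor coefficients of bounded normalized functions\<close>

text \<open>Exchanging the two exponents gives a geometric sum whose ratio
  \<open>\<omega> ^ l\<close> is an \<open>n\<close>-th root of unity and equals 1 exactly when
  \<open>n\<close> divides \<open>l\<close>.\<close>

lemma sum_roots_of_unity_power:
  fixes n l :: nat
  assumes "n \<ge> 1"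
  defines "\<omega> \<equiv> exp (2 * of_real pi * \<i> / of_nat n)"
  shows "(\<Sum>j<n. (\<omega> ^ j) ^ l) = (if n dvd l then of_nat n else 0)"
proof -
  have pow: "\<omega> ^ l = exp (2 * of_real pi * \<i> * of_nat l / of_nat n)" for l
    by (simp add: \<omega>_def flip: exp_of_nat_mult) (simp add: mult_ac)
  have 1: "\<omega> ^ l = 1 \<longleftrightarrow> n dvd l" for l
    unfolding pow using assms(1) by (rule complex_root_unity_eq_1)
  have eq: "(\<Sum>j<n. (\<omega> ^ j) ^ l) = (\<Sum>j<n. (\<omega> ^ l) ^ j)"
    by (simp add: mult.commute flip: power_mult)
  show ?thesis
  proof (cases "n dvd l")
    case True
    then show ?thesis using eq 1[of l] by simp
  next
    case False
    have "(\<omega> ^ l) ^ n = 1"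
      using 1[of "l * n"] by (simp add: power_mult)
    then show ?thesis using eq 1[of l] False by (simp add: geometric_sum)
  qed
qed

text \<open>The averaged function \<open>H\<close> has value \<open>b 0\<close> and derivative
  \<open>b n\<close> at 0, so the claim is the Schwarz-Pick inequality for \<open>H\<close> at the
  origin.\<close>

lemma power_series_coeff_bound:
  fixes b :: "nat \<Rightarrow> complex"
  assumes sums: "\<And>z. norm z < 1 \<Longrightarrow> (\<lambda>l. b l * z ^ l) sums g z"
    and bound: "\<And>z. norm z < 1 \<Longrightarrow> norm (g z) < 1"
    and n: "n \<ge> 1"
  shows "norm (b n) \<le> 1 - (norm (b 0))\<^sup>2"
proof -
  define \<omega> where "\<omega> = exp (2 * of_real pi * \<i> / of_nat n)"
  define H where "H w = (\<Sum>k. b (n * k) * w ^ k)" for w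
  have norm_\<omega>: "norm \<omega> = 1"
  proof -
    have "2 * of_real pi * \<i> / of_nat n = \<i> * of_real (2 * pi / n)"
      by simp
    then show ?thesis unfolding \<omega>_def by (metis norm_exp_i_times)
  qed
  \<comment> \<open>Averaging \<open>g\<close> over the rotations by the \<open>n\<close>-th roots of unity keeps the bound and leaves
    a power series in \<open>z ^ n\<close>.\<close>
  have H: "(\<lambda>k. b (n * k) * w ^ k) sums H w \<and> norm (H w) < 1" if w: "norm w < 1" for w
  proof -
    \<comment> \<open>An \<open>n\<close>-th root \<open>z\<close> of \<open>w\<close> turns the
      surviving powers \<open>z ^ (n * k)\<close> into \<open>w ^ k\<close>.\<close>
    obtain z where z: "w = z ^ n"
      using exists_complex_root n by (metis not_one_le_zero)
    have nz: "norm z < 1"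
      using w n by (simp add: z norm_power power_less_one_iff)
    have nzj: "norm (\<omega> ^ j * z) < 1" for j
      using nz by (simp add: norm_mult norm_power norm_\<omega>)
    define A where "A = (\<Sum>j<n. g (\<omega> ^ j * z)) / of_nat n"
    have "(\<lambda>l. (\<Sum>j<n. b l * (\<omega> ^ j * z) ^ l) / of_nat n) sums A"
      unfolding A_def by (intro sums_divide sums_sum sums nzj)
    moreover have "(\<Sum>j<n. b l * (\<omega> ^ j * z) ^ l) / of_nat n = (if n dvd l then b l * z ^ l else 0)"
      for l
    proof -
      have "(\<Sum>j<n. b l * (\<omega> ^ j * z) ^ l) = b l * z ^ l * (\<Sum>j<n. (\<omega> ^ j) ^ l)"
        by (simp add: sum_distrib_left power_mult_distrib mult_ac)
      then show ?thesis
        using n sum_roots_of_unity_power[OF n, of l] by (simp add: \<omega>_def)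
    qed
    ultimately have "(\<lambda>l. if n dvd l then b l * z ^ l else 0) sums A"
      by simp
    moreover have "strict_mono (\<lambda>k. n * k)"
      using n by (simp add: strict_mono_def)
    ultimately have "(\<lambda>k. b (n * k) * z ^ (n * k)) sums A"
      by (subst (asm) sums_mono_reindex[symmetric, where g = "\<lambda>k. n * k"]) (auto simp: dvd_def)
    then have s: "(\<lambda>k. b (n * k) * w ^ k) sums A"
      by (simp add: z power_mult)
    have "norm (\<Sum>j<n. g (\<omega> ^ j * z)) \<le> (\<Sum>j<n. norm (g (\<omega> ^ j * z)))"
      by (rule norm_sum)
    also have "\<dots> < (\<Sum>j<n. 1)"
      using n by (intro sum_strict_mono bound nzj) (auto simp: lessThan_empty_iff)
    finally have "norm A < 1"
      using n by (simp add: A_def norm_divide)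
    then show ?thesis
      using s sums_unique[OF s] by (simp add: H_def)
  qed
  have holH: "H holomorphic_on ball 0 1"
    by (rule power_series_holomorphic[where a = "\<lambda>k. b (n * k)"]) (use H in auto)
  have H0: "H 0 = b 0"
    by (simp add: H_def)
  have b0: "norm (b 0) < 1"
    using H[of 0] H0 by simp
  have DH: "(H has_field_derivative b n) (at 0)"
  proof -
    have "(H has_field_derivative (\<Sum>k. diffs (\<lambda>k. b (n * k)) k * 0 ^ k)) (at 0)"
      unfolding H_def[abs_def]
      by (rule termdiffs_strong'[where K = 1]) (use H sums_summable in auto)
    then show ?thesis
      by (simp add: diffs_def)
  qed
  define c where "c = 1 - cnj (b 0) * b 0"
  have c: "c = of_real (1 - (norm (b 0))\<^sup>2)"
    unfolding c_def by (metis complex_norm_square mult.commute of_real_1 of_real_diff)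
  have pos: "0 < 1 - (norm (b 0))\<^sup>2"
    using b0 by (simp add: power_less_one_iff)
  have c0: "c \<noteq> 0"
    using pos unfolding c by (metis less_irrefl of_real_eq_0_iff)
  \<comment> \<open>The Moebius map sends \<open>H 0\<close> to 0, so that the Schwarz lemma
    applies; its derivative at \<open>b 0\<close> is \<open>1 / c\<close>.\<close>
  define \<phi> where "\<phi> = Moebius_function 0 (b 0) \<circ> H"
  have "norm (deriv \<phi> 0) \<le> 1"
  proof (rule Schwarz_Lemma)
    show "\<phi> holomorphic_on ball 0 1"
      unfolding \<phi>_def
      by (rule holomorphic_on_compose_gen[OF holH Moebius_function_holomorphic[OF b0]])
        (use H in auto)
    show "\<phi> 0 = 0"
      by (simp add: \<phi>_def H0 Moebius_function_eq_zero)
    show "norm (\<phi> z) < 1" if "norm z < 1" for z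
      using H that b0 by (simp add: \<phi>_def Moebius_function_norm_lt_1)
    show "norm (0::complex) < 1" by simp
  qed
  moreover have "(\<phi> has_field_derivative b n / c) (at 0)"
    unfolding \<phi>_def comp_def Moebius_function_simple
    by (rule derivative_eq_intros DH refl | use c0 in \<open>simp add: H0 c_def[symmetric]\<close>)+
  ultimately have "norm (b n) / (1 - (norm (b 0))\<^sup>2) \<le> 1"
    using pos by (metis DERIV_imp_deriv abs_of_pos c norm_divide norm_of_real)
  then show ?thesis
    using pos by (simp add: divide_le_eq)
qed

text \<open>For \<open>K > M\<close> the quotient \<open>f z / (K * z)\<close> maps the disk into
  itself and extends to 0 with value \<open>1 / K\<close>. Its higher coefficients are thus at most
  \<open>1 - 1 / K\<^sup>2\<close>; multiplying by \<open>K\<close> and letting \<open>K\<close>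
  tend to \<open>M\<close> gives the bound.\<close>

lemma normalized_bounded_coeff:
  assumes hol: "f holomorphic_on ball 0 1"
    and f0: "f 0 = 0" and f1: "deriv f 0 = 1"
    and bound: "\<And>z. z \<in> ball 0 1 \<Longrightarrow> norm (f z) \<le> M"
  shows "M \<ge> 1"
    and "\<And>n. norm ((deriv ^^ (n + 2)) f 0 / fact (n + 2)) \<le> M - 1 / M"
proof -
  have M0: "M \<ge> 0"
    using bound[of 0] f0 by simp
  \<comment> \<open>The Schwarz lemma needs strict bounds, hence the detour through all \<open>K > M\<close>.\<close>
  have schwarz: "norm (f z) \<le> K * norm z \<and> 1 \<le> K" if K: "K > M" and z: "norm z < 1" for K z
  proof -
    define h where "h z = f z / of_real K" for z
    have K0: "K > 0" using K M0 by simp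
    have "h holomorphic_on ball 0 1"
      unfolding h_def using hol K0 by (intro holomorphic_intros) auto
    moreover have "h 0 = 0"
      by (simp add: h_def f0)
    moreover have "norm (h z) < 1" if "norm z < 1" for z
      using bound[of z] that K K0 by (simp add: h_def norm_divide)
    ultimately have "norm (h z) \<le> norm z" "norm (deriv h 0) \<le> 1"
      using Schwarz_Lemma[of h z] z by auto
    moreover have "(f has_field_derivative 1) (at 0)"
      using hol f1 by (metis centre_in_ball holomorphic_derivI open_ball zero_less_one)
    then have "(h has_field_derivative 1 / of_real K) (at 0)"
      unfolding h_def by (rule DERIV_cdivide)
    then have "deriv h 0 = 1 / of_real K"
      by (rule DERIV_imp_deriv)
    ultimately show ?thesis
      using K0 by (simp add: h_def norm_divide divide_le_eq mult.commute)
  qed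
  show M1: "M \<ge> 1"
  proof (rule dense_ge)
    show "1 \<le> K" if "M < K" for K using schwarz[OF that, of 0] by simp
  qed
  fix n
  \<comment> \<open>The index is shifted by one: \<open>a n\<close> is the coefficient of order
    \<open>n\<close> of \<open>f z / z\<close>, extended to 0 by its limit 1.\<close>
  define a where "a n = (deriv ^^ (n + 1)) f 0 / fact (n + 1)" for n
  have a0: "a 0 = 1"
    by (simp add: a_def f1)
  define g where "g z = (if z = 0 then 1 else f z / z)" for z
  have g: "(\<lambda>l. a l * z ^ l) sums g z" if z: "norm z < 1" for z
  proof (cases "z = 0")
    case True
    then show ?thesis
      using powser_sums_zero[of a] by (simp add: g_def a0)
  next
    case False
    have "(\<lambda>l. (deriv ^^ l) f 0 / fact l * (z - 0) ^ l) sums f z"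
      using z by (intro holomorphic_power_series[OF hol]) auto
    then have "(\<lambda>l. (deriv ^^ (l + 1)) f 0 / fact (l + 1) * z ^ (l + 1)) sums f z"
      by (subst sums_iff_shift) (simp add: f0)
    then have "(\<lambda>l. a l * z ^ (l + 1) / z) sums (f z / z)"
      unfolding a_def by (rule sums_divide)
    then show ?thesis
      using False by (simp add: g_def)
  qed
  have K: "norm (a (n + 1)) \<le> K - 1 / K" if MK: "M < K" for K
  proof -
    \<comment> \<open>The Schwarz lemma at level \<open>L\<close> gives a non-strict bound for
      \<open>g\<close>; \<open>L < K\<close> makes the bound for \<open>g z / K\<close>
      strict.\<close>
    obtain L where L: "M < L" "L < K"
      using dense[OF MK] by auto
    have K0: "K > 1" using M1 MK by simp
    have gL: "norm (g z) \<le> L" if "norm z < 1" for z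
      using schwarz[OF L(1) that] by (auto simp: g_def norm_divide divide_le_eq)
    have "norm (a (n + 1) / of_real K) \<le> 1 - (norm (a 0 / of_real K))\<^sup>2"
    proof (rule power_series_coeff_bound[where g = "\<lambda>z. g z / of_real K"])
      show "(\<lambda>l. a l / of_real K * z ^ l) sums (g z / of_real K)" if "norm z < 1" for z
        using sums_divide[OF g[OF that], of "of_real K"] by simp
      show "norm (g z / of_real K) < 1" if "norm z < 1" for z
        using gL[OF that] L K0 by (simp add: norm_divide)
    qed simp
    then show ?thesis
      using K0 by (simp add: a0 norm_divide field_simps power2_eq_square)
  qed
  have "norm (a (n + 1)) \<le> M - 1 / M"
  proof (rule field_le_epsilon)
    fix e :: real
    assume e: "0 < e"
    \<comment> \<open>For \<open>K = M + e / 2\<close>, the bound \<open>K - 1 / K\<close> exceeds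
      \<open>M - 1 / M\<close> by \<open>e / 2\<close> plus this difference.\<close>
    have "1 / M - 1 / (M + e / 2) \<le> e / 2"
    proof -
      have "1 / M - 1 / (M + e / 2) = (e / 2) / (M * (M + e / 2))"
        using e M1 by (simp add: field_simps)
      also have "\<dots> \<le> (e / 2) / 1"
        using e M1 mult_mono[of 1 M 1 "M + e / 2"] by (intro divide_left_mono) auto
      finally show ?thesis by simp
    qed
    then show "norm (a (n + 1)) \<le> M - 1 / M + e"
      using K[of "M + e / 2"] e by simp
  qed
  then show "norm ((deriv ^^ (n + 2)) f 0 / fact (n + 2)) \<le> M - 1 / M"
    by (simp add: a_def)
qed

section \<open>Lipschitz and growth estimates for the terms of the expansion\<close>

text \<open>Factoring out \<open>a - b\<close> leaves \<open>n\<close> products of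
  \<open>n - 1\<close> factors. The general field covers both complex powers and powers of the real
  moduli.\<close>

lemma norm_power_diff_le:
  fixes a b :: "'a::real_normed_field"
  assumes "norm a \<le> \<rho>" "norm b \<le> \<rho>"
  shows "norm (a ^ n - b ^ n) \<le> real n * \<rho> ^ (n - 1) * norm (a - b)"
proof -
  have r: "0 \<le> \<rho>" using assms(1) norm_ge_zero order_trans by blast
  have "norm (\<Sum>i<n. b ^ (n - Suc i) * a ^ i) \<le> (\<Sum>i<n. \<rho> ^ (n - 1))"
  proof (rule sum_norm_le)
    fix i assume i: "i \<in> {..<n}"
    have "norm (b ^ (n - Suc i) * a ^ i) \<le> \<rho> ^ (n - Suc i) * \<rho> ^ i"
      unfolding norm_mult norm_power using assms r by (intro mult_mono power_mono) auto
    also have "\<dots> = \<rho> ^ (n - 1)"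
      using i by (simp flip: power_add)
    finally show "norm (b ^ (n - Suc i) * a ^ i) \<le> \<rho> ^ (n - 1)" .
  qed
  then have "norm (a - b) * norm (\<Sum>i<n. b ^ (n - Suc i) * a ^ i) \<le> norm (a - b) * (real n * \<rho> ^ (n - 1))"
    by (intro mult_left_mono) auto
  then show ?thesis
    by (simp add: power_diff_sumr2 norm_mult mult_ac)
qed

text \<open>A product rule for differences: first the power changes, then the modulus, which is
  Lipschitz by the reverse triangle inequality.\<close>

lemma norm_monomial_diff_le:
  fixes a b :: complex
  assumes a: "norm a \<le> \<rho>" and b: "norm b \<le> \<rho>"
  shows "norm (of_real (norm a ^ (2 * k)) * a ^ Suc j - of_real (norm b ^ (2 * k)) * b ^ Suc j)
    \<le> (2 * real k + real (Suc j)) * \<rho> ^ (2 * k + j) * norm (a - b)"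
proof -
  have r: "0 \<le> \<rho>" using a norm_ge_zero order_trans by blast
  define A where "A = norm a ^ (2 * k)"
  define B where "B = norm b ^ (2 * k)"
  have "of_real A * a ^ Suc j - of_real B * b ^ Suc j
      = of_real A * (a ^ Suc j - b ^ Suc j) + of_real (A - B) * b ^ Suc j"
    by (simp add: algebra_simps)
  also have "norm \<dots> \<le> norm (of_real A * (a ^ Suc j - b ^ Suc j)) + norm (of_real (A - B) * b ^ Suc j)"
    by (rule norm_triangle_ineq)
  also have "norm (of_real A * (a ^ Suc j - b ^ Suc j)) \<le> \<rho> ^ (2 * k) * (real (Suc j) * \<rho> ^ j * norm (a - b))"
    unfolding norm_mult using a r norm_power_diff_le[OF a b, of "Suc j"]
    by (intro mult_mono) (auto simp: A_def norm_power intro!: power_mono)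
  also have "norm (of_real (A - B) * b ^ Suc j) \<le> (2 * real k * \<rho> ^ (2 * k - 1) * norm (a - b)) * \<rho> ^ Suc j"
    unfolding norm_mult norm_power norm_of_real
  proof (intro mult_mono power_mono b)
    have "\<bar>A - B\<bar> \<le> real (2 * k) * \<rho> ^ (2 * k - 1) * \<bar>norm a - norm b\<bar>"
      unfolding A_def B_def using norm_power_diff_le[of "norm a" \<rho> "norm b" "2 * k"] a b by simp
    also have "\<dots> \<le> real (2 * k) * \<rho> ^ (2 * k - 1) * norm (a - b)"
      using r by (intro mult_left_mono norm_triangle_ineq3) auto
    finally show "\<bar>A - B\<bar> \<le> 2 * real k * \<rho> ^ (2 * k - 1) * norm (a - b)" by simp
  qed (use r in auto)
  \<comment> \<open>For \<open>k = 0\<close> the truncated exponent \<open>2 * k - 1\<close> does no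
    harm, since its summand carries the factor \<open>k\<close>.\<close>
  also have "\<rho> ^ (2 * k) * (real (Suc j) * \<rho> ^ j * norm (a - b))
      + (2 * real k * \<rho> ^ (2 * k - 1) * norm (a - b)) * \<rho> ^ Suc j
      = (2 * real k + real (Suc j)) * \<rho> ^ (2 * k + j) * norm (a - b)"
    by (cases k) (simp_all add: power_add algebra_simps)
  finally show ?thesis by (simp add: A_def B_def)
qed

text \<open>The Taylor series of \<open>f z - z\<close> starts at order 2; the monomial estimate
  with \<open>j = n + 1\<close> applies termwise, and the majorant has a closed form.\<close>

lemma higher_terms_lipschitz:
  assumes hol: "f holomorphic_on ball 0 1"
    and f0: "f 0 = 0" and f1: "deriv f 0 = 1"
    and bound: "\<And>z. z \<in> ball 0 1 \<Longrightarrow> norm (f z) \<le> M"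
    and a: "norm a \<le> \<rho>" and b: "norm b \<le> \<rho>" and \<rho>: "\<rho> < 1"
  shows "norm (of_real (norm a ^ (2 * k)) * (f a - a) - of_real (norm b ^ (2 * k)) * (f b - b))
    \<le> (M - 1 / M) * (((2 * real k * (1 - \<rho>) + (2 - \<rho>)) * \<rho> ^ (2 * k + 1)) / (1 - \<rho>)\<^sup>2) * norm (a - b)"
proof -
  have r: "0 \<le> \<rho>" using a norm_ge_zero order_trans by blast
  define c where "c n = (deriv ^^ (n + 2)) f 0 / fact (n + 2)" for n
  have c: "norm (c n) \<le> M - 1 / M" for n
    unfolding c_def by (rule normalized_bounded_coeff(2)[OF hol f0 f1 bound])
  have sums: "(\<lambda>n. of_real (norm z ^ (2 * k)) * (c n * z ^ (n + 2)))
      sums (of_real (norm z ^ (2 * k)) * (f z - z))" if z: "norm z < 1" for z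
  proof -
    have "(\<lambda>n. (deriv ^^ n) f 0 / fact n * (z - 0) ^ n) sums f z"
      using z by (intro holomorphic_power_series[OF hol]) auto
    then have "(\<lambda>n. c n * z ^ (n + 2)) sums (f z - z)"
      unfolding c_def by (subst sums_iff_shift) (simp add: f0 f1 eval_nat_numeral)
    then show ?thesis by (rule sums_mult)
  qed
  define d where "d n = c n * (of_real (norm a ^ (2 * k)) * a ^ Suc (Suc n)
    - of_real (norm b ^ (2 * k)) * b ^ Suc (Suc n))" for n
  have d: "d sums (of_real (norm a ^ (2 * k)) * (f a - a) - of_real (norm b ^ (2 * k)) * (f b - b))"
    using sums_diff[OF sums[of a] sums[of b]] a b \<rho> by (simp add: d_def[abs_def] algebra_simps)
  define e where "e n = (M - 1 / M) * ((2 * real k + real (Suc (Suc n))) * \<rho> ^ (2 * k + Suc n) * norm (a - b))" for n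
  have de: "norm (d n) \<le> e n" for n
    unfolding d_def e_def norm_mult using order_trans[OF norm_ge_zero c]
    by (intro mult_mono norm_monomial_diff_le[OF a b] c) auto
  define S where "S = (M - 1 / M) * (((2 * real k * (1 - \<rho>) + (2 - \<rho>)) * \<rho> ^ (2 * k + 1)) / (1 - \<rho>)\<^sup>2) * norm (a - b)"
  have "e sums S"
  proof -
    \<comment> \<open>The factor \<open>2 * k + n + 2\<close> splits into \<open>n + 1\<close> and
      \<open>2 * k + 1\<close>, leaving the differentiated geometric series and the geometric series
      itself.\<close>
    have "(\<lambda>n. (M - 1 / M) * \<rho> ^ (2 * k + 1) * norm (a - b) *
        (of_nat (Suc n) * \<rho> ^ n + (2 * real k + 1) * \<rho> ^ n)) sums
        ((M - 1 / M) * \<rho> ^ (2 * k + 1) * norm (a - b) * (1 / (1 - \<rho>)\<^sup>2 + (2 * real k + 1) * (1 / (1 - \<rho>))))"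
      using r \<rho> by (intro sums_mult sums_add geometric_deriv_sums geometric_sums) auto
    moreover have "(M - 1 / M) * \<rho> ^ (2 * k + 1) * norm (a - b) *
        (of_nat (Suc n) * \<rho> ^ n + (2 * real k + 1) * \<rho> ^ n) = e n" for n
      by (simp add: e_def power_add algebra_simps)
    moreover have "1 / (1 - \<rho>)\<^sup>2 + (2 * real k + 1) * (1 / (1 - \<rho>))
        = (2 * real k * (1 - \<rho>) + (2 - \<rho>)) / (1 - \<rho>)\<^sup>2"
      using \<rho> by (simp add: divide_simps power2_eq_square) (simp add: algebra_simps)
    ultimately show ?thesis by (simp add: S_def mult_ac)
  qed
  then show ?thesis
    using norm_suminf_le[of d e] de d sums_summable sums_unique unfolding S_def by metis
qed

text \<open>A geometric series with factor \<open>M - 1 / M\<close> majorizes the Taylor series from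
  order 2 on. This estimate of size, not of increments, serves the covering statement.\<close>

lemma higher_terms_bound:
  assumes hol: "f holomorphic_on ball 0 1"
    and f0: "f 0 = 0" and f1: "deriv f 0 = 1"
    and bound: "\<And>z. z \<in> ball 0 1 \<Longrightarrow> norm (f z) \<le> M"
    and z: "norm z < 1"
  shows "norm (f z - z) \<le> (M - 1 / M) * ((norm z)\<^sup>2 / (1 - norm z))"
proof -
  define c where "c n = (deriv ^^ (n + 2)) f 0 / fact (n + 2)" for n
  have c: "norm (c n) \<le> M - 1 / M" for n
    unfolding c_def by (rule normalized_bounded_coeff(2)[OF hol f0 f1 bound])
  have "(\<lambda>n. (deriv ^^ n) f 0 / fact n * (z - 0) ^ n) sums f z"
    using z by (intro holomorphic_power_series[OF hol]) auto
  then have s: "(\<lambda>n. c n * z ^ (n + 2)) sums (f z - z)"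
    unfolding c_def by (subst sums_iff_shift) (simp add: f0 f1 eval_nat_numeral)
  have "(\<lambda>n. (M - 1 / M) * (norm z)\<^sup>2 * norm z ^ n) sums ((M - 1 / M) * (norm z)\<^sup>2 * (1 / (1 - norm z)))"
    using z by (intro sums_mult geometric_sums) auto
  moreover have "norm (c n * z ^ (n + 2)) \<le> (M - 1 / M) * (norm z)\<^sup>2 * norm z ^ n" for n
    using mult_right_mono[OF c, of "norm z ^ (n + 2)" n]
    by (simp add: norm_mult norm_power power_add mult_ac power2_eq_square)
  ultimately have "norm (f z - z) \<le> (M - 1 / M) * (norm z)\<^sup>2 * (1 / (1 - norm z))"
    using norm_suminf_le s sums_summable sums_unique by (metis (no_types, lifting))
  then show ?thesis by simp
qed

section \<open>From a lower bound on the circle to a schlicht disk\<close>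

text \<open>The circle is mapped outside the target disk, so two disjoint open sets cover that disk:
  the image of the open disk and the complement of the image of the closed disk. Connectedness and
  \<open>F 0 = 0\<close> leave only the first.\<close>

lemma contains_schlicht_disk_of_sphere_bound:
  assumes cont: "continuous_on (cball 0 r) F" and inj: "inj_on F (ball 0 r)"
    and F0: "F 0 = 0" and r: "0 < r" and \<rho>: "0 < \<rho>"
    and sphere: "\<And>z. norm z = r \<Longrightarrow> \<rho> \<le> norm (F z)"
  shows "contains_schlicht_disk F (ball 0 r) 0 \<rho>"
proof -
  have contb: "continuous_on (ball 0 r) F"
    using cont by (rule continuous_on_subset) auto
  have openV: "open (F ` ball 0 r)"
    by (rule invariance_of_domain[OF contb _ inj]) simp
  have closedK: "closed (F ` cball 0 r)"
    using cont by (simp add: compact_continuous_image compact_imp_closed)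
  have "F ` ball 0 r \<inter> ball 0 \<rho> = {} \<or> - (F ` cball 0 r) \<inter> ball 0 \<rho> = {}"
  proof (rule connectedD[OF connected_ball openV])
    show "open (- (F ` cball 0 r))" using closedK by (simp add: open_Compl)
    show "F ` ball 0 r \<inter> - (F ` cball 0 r) \<inter> ball 0 \<rho> = {}" by force
    show "ball 0 \<rho> \<subseteq> F ` ball 0 r \<union> - (F ` cball 0 r)"
      using sphere by (force simp: less_le)
  qed
  moreover have "0 \<in> F ` ball 0 r \<inter> ball 0 \<rho>"
    using F0 r \<rho> by force
  ultimately have subK: "ball 0 \<rho> \<subseteq> F ` cball 0 r"
    by blast
  have sub: "ball 0 \<rho> \<subseteq> F ` ball 0 r"
  proof
    fix w :: complex
    assume w: "w \<in> ball 0 \<rho>"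
    then obtain z where z: "norm z \<le> r" "w = F z"
      using subK by force
    then have "norm z < r"
      using w sphere[of z] by (cases "norm z = r") auto
    then show "w \<in> F ` ball 0 r"
      using z by auto
  qed
  obtain g where g: "homeomorphism (ball 0 r) (F ` ball 0 r) F g"
    using invariance_of_domain_homeomorphism[OF _ contb _ inj] by auto
  \<comment> \<open>\<open>U\<close> is open as a preimage, and connected as the image of a disk
    under the inverse \<open>g\<close>.\<close>
  define U where "U = ball 0 r \<inter> F -` ball 0 \<rho>"
  have Ug: "U = g ` ball 0 \<rho>"
  proof (intro equalityI subsetI)
    fix z assume "z \<in> U"
    then show "z \<in> g ` ball 0 \<rho>"
      using homeomorphism_apply1[OF g, of z] unfolding U_def by (metis IntE image_eqI vimageE)
  next
    fix z assume "z \<in> g ` ball 0 \<rho>"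
    then obtain w where w: "w \<in> ball 0 \<rho>" "z = g w" by blast
    then have "w \<in> F ` ball 0 r" using sub by blast
    then show "z \<in> U"
      using w homeomorphism_apply2[OF g] homeomorphism_image2[OF g] unfolding U_def by auto
  qed
  have "open U"
    unfolding U_def by (rule continuous_open_preimage[OF contb]) auto
  moreover have "connected U"
    unfolding Ug using g sub
    by (intro connected_continuous_image connected_ball) (auto simp: homeomorphism_def intro: continuous_on_subset)
  moreover have "F ` U = ball 0 \<rho>"
    using sub unfolding U_def by blast
  moreover have "U \<subseteq> ball 0 r"
    by (simp add: U_def)
  ultimately show ?thesis
    using inj \<rho> unfolding contains_schlicht_disk_def by (meson inj_on_subset)
qed

text \<open>The chain rule along the directions 1 and \<open>\<i>\<close> yields the partial
  derivatives \<open>D\<close> and \<open>\<i> * D\<close>.\<close>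

lemma wirtinger_z_eq_complex_deriv:
  assumes "(F has_field_derivative D) (at z)"
  shows "wirtinger_z F z = D"
proof -
  have line: "((\<lambda>t::real. F (z + c * of_real t)) has_vector_derivative c * D) (at 0)" for c
  proof -
    have "((\<lambda>t::real. z + c * of_real t) has_vector_derivative c) (at 0)"
      unfolding has_vector_derivative_def
      by (auto intro!: derivative_eq_intros simp: scaleR_conv_of_real)
    then show ?thesis
      using field_vector_diff_chain_at[of "\<lambda>t::real. z + c * of_real t" c 0 F D] assms
      by (simp add: comp_def)
  qed
  show ?thesis
    using line[of 1] line[of \<i>]
    unfolding wirtinger_z_def partial_x_def partial_y_def
    by (simp add: vector_derivative_at)
qed

section \<open>The equation for the radius of univalence\<close>

text \<open>Pulling out one factor \<open>r\<close> yields strict monotonicity of \<open>univalence_fun\<close> below a root without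
  asking which of the summands are nonzero.\<close>

definition univalence_slope :: "nat \<Rightarrow> (nat \<Rightarrow> real) \<Rightarrow> real \<Rightarrow> real" where
  "univalence_slope m M r =
     (\<Sum>k<m. (M k - 1 / M k) * (r ^ (2 * k) * (1 / (1 - r)\<^sup>2 + (2 * real k + 1) / (1 - r))))
     + (\<Sum>k=1..<m. (2 * real k + 1) * r ^ (2 * k - 1))"

lemma univalence_fun_eq_slope:
  assumes "r < 1"
  shows "univalence_fun m M r = 1 - r * univalence_slope m M r"
proof -
  have 1: "((2 * real k * (1 - r) + (2 - r)) * r ^ (2 * k + 1)) / (1 - r)\<^sup>2
      = r * (r ^ (2 * k) * (1 / (1 - r)\<^sup>2 + (2 * real k + 1) / (1 - r)))" for k
  proof -
    have "(2 * real k * (1 - r) + (2 - r)) / (1 - r)\<^sup>2 = 1 / (1 - r)\<^sup>2 + (2 * real k + 1) / (1 - r)"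
      using assms by (simp add: divide_simps power2_eq_square) (simp add: algebra_simps)
    then show ?thesis
      by (simp flip: times_divide_eq_left)
  qed
  have 2: "(\<Sum>k=1..<m. (2 * real k + 1) * r ^ (2 * k)) = r * (\<Sum>k=1..<m. (2 * real k + 1) * r ^ (2 * k - 1))"
    unfolding sum_distrib_left
  proof (rule sum.cong)
    fix k assume "k \<in> {1..<m}"
    then have "r ^ (2 * k) = r * r ^ (2 * k - 1)"
      by (simp flip: power_Suc)
    then show "(2 * real k + 1) * r ^ (2 * k) = r * ((2 * real k + 1) * r ^ (2 * k - 1))"
      by simp
  qed simp
  show ?thesis
    unfolding univalence_fun_def univalence_slope_def 1 2
    by (simp add: sum_distrib_left distrib_left mult_ac)
qed

lemma minus_inverse_nonneg:
  fixes x :: real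
  assumes "1 \<le> x"
  shows "0 \<le> x - 1 / x"
proof -
  have "1 / x \<le> 1" using assms by (simp add: divide_le_eq)
  then show ?thesis using assms by linarith
qed

lemma univalence_slope_mono:
  assumes M: "\<And>k. k < m \<Longrightarrow> 1 \<le> M k" and "0 \<le> x" "x \<le> y" "y < 1"
  shows "univalence_slope m M x \<le> univalence_slope m M y"
  unfolding univalence_slope_def
proof (intro add_mono sum_mono mult_left_mono mult_mono power_mono)
  fix k
  show "1 / (1 - x)\<^sup>2 \<le> 1 / (1 - y)\<^sup>2"
    using assms by (intro divide_left_mono power_mono) auto
  show "(2 * real k + 1) / (1 - x) \<le> (2 * real k + 1) / (1 - y)"
    using assms by (intro divide_left_mono) auto
  show "0 \<le> M k - 1 / M k" if "k \<in> {..<m}"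
    using that M minus_inverse_nonneg by simp
qed (use assms in auto)

text \<open>At the root \<open>y * univalence_slope m M y = 1\<close>, so the slope is positive
  there, and the factor \<open>x < y\<close> makes the inequality strict.\<close>

lemma univalence_fun_pos_below_root:
  assumes M: "\<And>k. k < m \<Longrightarrow> 1 \<le> M k"
    and "0 \<le> x" "x < y" "y < 1" and root: "univalence_fun m M y = 0"
  shows "0 < univalence_fun m M x"
proof -
  have y: "y * univalence_slope m M y = 1"
    using root univalence_fun_eq_slope assms by simp
  have pos: "0 < univalence_slope m M y"
    by (rule ccontr) (use y assms mult_nonneg_nonpos[of y "univalence_slope m M y"] in auto)
  have "x * univalence_slope m M x \<le> x * univalence_slope m M y"
    using assms by (intro mult_left_mono univalence_slope_mono) auto
  also have "\<dots> < y * univalence_slope m M y"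
    using assms pos by simp
  finally show ?thesis
    using y univalence_fun_eq_slope[of x m M] assms by simp
qed

text \<open>In the excluded case the function is constantly 1. Otherwise the pole at 1 forces a
  negative value if \<open>m = 1\<close>, and the summand \<open>3 * r\<^sup>2\<close> does so if
  \<open>m > 1\<close>.\<close>

lemma univalence_fun_negative_value:
  assumes m: "m \<ge> 1" and M: "\<And>k. k < m \<Longrightarrow> 1 \<le> M k" and nontrivial: "\<not> (m = 1 \<and> M 0 = 1)"
  obtains r where "0 < r" "r < 1" "univalence_fun m M r < 0"
proof (cases "m = 1")
  case True
  define c where "c = M 0 - 1 / M 0"
  have M0: "M 0 > 1" using M[of 0] True nontrivial by auto
  have c: "c > 0"
    unfolding c_def using M0 by (simp add: field_simps less_1_mult)
  \<comment> \<open>At \<open>1 - s\<close> the function has the sign of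
    \<open>s\<^sup>2 * (1 + c) - c\<close>, which this choice makes negative because
    \<open>s\<^sup>2 < s\<close>.\<close>
  define s where "s = c / (1 + c)"
  have s: "0 < s" "s < 1" using c by (auto simp: s_def)
  have "s\<^sup>2 < s"
    using s by (simp add: power2_eq_square)
  then have "s\<^sup>2 * (1 + c) < c"
    using c by (simp add: s_def pos_less_divide_eq)
  then have "s\<^sup>2 - c * (1 - s\<^sup>2) < 0"
    by (simp add: algebra_simps)
  moreover have "univalence_fun m M (1 - s) = (s\<^sup>2 - c * (1 - s\<^sup>2)) / s\<^sup>2"
    using s True by (simp add: univalence_fun_def c_def field_simps power2_eq_square)
  ultimately have "univalence_fun m M (1 - s) < 0"
    using s by (simp add: divide_less_0_iff)
  then show ?thesis using that[of "1 - s"] s by simp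
next
  case False
  \<comment> \<open>Already the summand for \<open>k = 1\<close> equals 2.43 here and exceeds
    1.\<close>
  define r :: real where "r = 9 / 10"
  have "(\<Sum>k\<in>{1}. (2 * real k + 1) * r ^ (2 * k)) \<le> (\<Sum>k=1..<m. (2 * real k + 1) * r ^ (2 * k))"
    using False m by (intro sum_mono2) (auto simp: r_def)
  moreover have "0 \<le> (\<Sum>k<m. (M k - 1 / M k) * (((2 * real k * (1 - r) + (2 - r)) * r ^ (2 * k + 1)) / (1 - r)\<^sup>2))"
    using M minus_inverse_nonneg by (intro sum_nonneg mult_nonneg_nonneg) (auto simp: r_def)
  ultimately have "univalence_fun m M r < 0"
    unfolding univalence_fun_def by (simp add: r_def power2_eq_square)
  then show ?thesis using that[of r] by (simp add: r_def)
qed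

text \<open>The intermediate value theorem gives a root; of two roots, the smaller one would
  contradict positivity below the larger.\<close>

lemma ex1_root_univalence_fun:
  assumes m: "m \<ge> 1" and M: "\<And>k. k < m \<Longrightarrow> 1 \<le> M k" and nontrivial: "\<not> (m = 1 \<and> M 0 = 1)"
  shows "\<exists>!r. r \<in> {0<..<1} \<and> univalence_fun m M r = 0"
proof -
  have zero: "univalence_fun m M 0 = 1"
    by (simp add: univalence_fun_eq_slope)
  obtain R where R: "0 < R" "R < 1" "univalence_fun m M R < 0"
    using univalence_fun_negative_value[of m M] m M nontrivial by blast
  have "continuous_on {0..R} (univalence_fun m M)"
    unfolding univalence_fun_def using R by (intro continuous_intros) auto
  then obtain r where r: "0 \<le> r" "r \<le> R" "univalence_fun m M r = 0"
    using IVT2'[of "univalence_fun m M" R 0 0] R zero by auto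
  show ?thesis
  proof (rule ex1I)
    show "r \<in> {0<..<1} \<and> univalence_fun m M r = 0"
      using r R zero by (cases "r = 0") auto
    show "s = r" if "s \<in> {0<..<1} \<and> univalence_fun m M s = 0" for s
      using univalence_fun_pos_below_root[of m M s r] univalence_fun_pos_below_root[of m M r s] M r R that
      by (cases s r rule: linorder_cases) auto
  qed
qed

section \<open>Positivity of the covering radius\<close>

text \<open>The closed form is a geometric sum; undoing it allows comparison with the estimates term
  by term.\<close>

lemma covering_radius_eq_sum:
  assumes "m \<ge> 1" "0 < r" "r < 1"
  shows "covering_radius m M r = r - (\<Sum>k=1..<m. r ^ (2 * k + 1))
    - (\<Sum>k<m. (M k - 1 / M k) * (r ^ (2 * k + 2) / (1 - r)))"
proof -
  have "r\<^sup>2 < 1"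
    using assms by (simp add: power_less_one_iff)
  have "r * (r\<^sup>2 - r ^ (2 * m)) / (1 - r\<^sup>2) = (\<Sum>k=1..<m. r ^ (2 * k + 1))"
    using \<open>m \<ge> 1\<close>
  proof (induction rule: dec_induct)
    case (step n)
    have "r * (r\<^sup>2 - r ^ (2 * Suc n)) / (1 - r\<^sup>2) = r * (r\<^sup>2 - r ^ (2 * n)) / (1 - r\<^sup>2) + r ^ (2 * n + 1)"
      using \<open>r\<^sup>2 < 1\<close> by (simp add: field_simps power2_eq_square)
    then show ?case
      using step by simp
  qed simp
  then show ?thesis
    by (simp add: covering_radius_def)
qed

text \<open>Multiplied by \<open>r\<close>, the root equation writes \<open>r\<close> as a sum that
  is at least twice what \<open>covering_radius\<close> subtracts from \<open>r\<close>. Hence the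
  radius is at least \<open>r / 2\<close>.\<close>

lemma covering_radius_pos:
  assumes m: "m \<ge> 1" and M: "\<And>k. k < m \<Longrightarrow> 1 \<le> M k"
    and r: "0 < r" "r < 1" and root: "univalence_fun m M r = 0"
  shows "0 < covering_radius m M r"
proof -
  define A where "A k = (M k - 1 / M k) * (r ^ (2 * k + 2) / (1 - r))" for k
  define B where "B k = (M k - 1 / M k) *
    (((2 * real k * (1 - r) + (2 - r)) * r ^ (2 * k + 1)) / (1 - r)\<^sup>2)" for k
  \<comment> \<open>The function \<open>univalence_fun\<close> is the derivative of \<open>covering_radius\<close>; on the level of the
    individual summands this gives a factor of at least 2.\<close>
  have AB: "2 * A k \<le> r * B k" if "k < m" for k
  proof -
    have "2 * (r ^ (2 * k + 2) / (1 - r)) = (r ^ (2 * k + 2) / (1 - r)\<^sup>2) * (2 * (1 - r))"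
      using r by (simp add: divide_simps power2_eq_square)
    also have "\<dots> \<le> (r ^ (2 * k + 2) / (1 - r)\<^sup>2) * (2 * real k * (1 - r) + (2 - r))"
    proof (rule mult_left_mono)
      show "2 * (1 - r) \<le> 2 * real k * (1 - r) + (2 - r)"
        by (rule add_increasing) (use r in auto)
    qed (use r in auto)
    also have "\<dots> = r * (((2 * real k * (1 - r) + (2 - r)) * r ^ (2 * k + 1)) / (1 - r)\<^sup>2)"
      by simp
    finally show ?thesis
      unfolding A_def B_def
      by (subst (1 2) mult.left_commute) (rule mult_left_mono[OF _ minus_inverse_nonneg[OF M[OF that]]])
  qed
  have "2 * (\<Sum>k<m. A k) \<le> r * (\<Sum>k<m. B k)"
    unfolding sum_distrib_left by (intro sum_mono AB) auto
  moreover have "2 * (\<Sum>k=1..<m. r ^ (2 * k + 1)) \<le> r * (\<Sum>k=1..<m. (2 * real k + 1) * r ^ (2 * k))"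
    unfolding sum_distrib_left
  proof (rule sum_mono)
    fix k assume "k \<in> {1..<m}"
    then have "2 * r ^ (2 * k + 1) \<le> (2 * real k + 1) * r ^ (2 * k + 1)"
      using r by (intro mult_right_mono) auto
    then show "2 * r ^ (2 * k + 1) \<le> r * ((2 * real k + 1) * r ^ (2 * k))"
      by (simp add: mult_ac)
  qed
  moreover have "r = r * (\<Sum>k<m. B k) + r * (\<Sum>k=1..<m. (2 * real k + 1) * r ^ (2 * k))"
  proof -
    have "1 = (\<Sum>k<m. B k) + (\<Sum>k=1..<m. (2 * real k + 1) * r ^ (2 * k))"
      using root unfolding univalence_fun_def B_def by linarith
    then show ?thesis by (metis distrib_left mult.right_neutral)
  qed
  moreover have "covering_radius m M r = r - (\<Sum>k=1..<m. r ^ (2 * k + 1)) - (\<Sum>k<m. A k)"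
    unfolding A_def by (rule covering_radius_eq_sum[OF m r])
  ultimately show ?thesis
    using r by linarith
qed

section \<open>Univalence and covering for the poly-analytic function\<close>

text \<open>The product is of size at most \<open>M * norm z ^ 2\<close>. Hence \<open>F\<close> is
  complex differentiable at 0 with the derivative of \<open>f 0\<close>, and the normalization of
  \<open>F\<close> passes to \<open>f 0\<close>.\<close>

lemma norm_power_mult_has_derivative_zero:
  assumes k: "k \<ge> 1" and f0: "f 0 = 0"
    and bound: "\<And>z. z \<in> ball 0 1 \<Longrightarrow> norm (f z :: complex) \<le> M"
  shows "((\<lambda>z. of_real (norm z ^ (2 * k)) * f z) has_field_derivative 0) (at 0)"
proof -
  have "((\<lambda>z. (of_real (norm z ^ (2 * k)) * f z - 0) / (z - 0)) \<longlongrightarrow> 0) (at 0)"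
  proof (rule Lim_null_comparison)
    show "\<forall>\<^sub>F z in at 0. norm ((of_real (norm z ^ (2 * k)) * f z - 0) / (z - 0)) \<le> M * norm z"
      unfolding eventually_at
    proof (intro exI[of _ 1] conjI ballI impI)
      fix z :: complex
      assume z: "z \<noteq> 0 \<and> dist z 0 < 1"
      have "norm z ^ (2 * k) \<le> norm z ^ 2"
        using k z by (intro power_decreasing) auto
      then have "norm z ^ (2 * k) * norm (f z) \<le> norm z ^ 2 * M"
        using bound[of z] z by (intro mult_mono) auto
      then show "norm ((of_real (norm z ^ (2 * k)) * f z - 0) / (z - 0)) \<le> M * norm z"
        using z by (simp add: norm_mult norm_divide norm_power divide_le_eq power2_eq_square mult_ac)
    qed simp
    show "((\<lambda>z::complex. M * norm z) \<longlongrightarrow> 0) (at 0)"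
      by (rule tendsto_eq_intros refl | simp)+
  qed
  then show ?thesis
    using f0 by (simp add: has_field_derivative_iff)
qed

text \<open>For \<open>m = 1\<close> and \<open>M 0 = 1\<close> the equation reads
  \<open>1 = 0\<close>, so existence of a root is claimed outside this case only; the geometric
  conclusions are stated for every root.\<close>

theorem theorem3p5:
  fixes m :: nat and M :: "nat \<Rightarrow> real"
    and f :: "nat \<Rightarrow> complex \<Rightarrow> complex" and F :: "complex \<Rightarrow> complex"
  assumes "m \<ge> 1"
    and "\<And>k. k < m \<Longrightarrow> M k \<ge> 0"
    and "\<And>k. k < m \<Longrightarrow> f k holomorphic_on ball 0 1"
    and "\<And>z. z \<in> ball 0 1 \<Longrightarrow> F z = (\<Sum>k<m. of_real (norm z ^ (2 * k)) * f k z)"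
    and "wirtinger_z F 0 = 1"
    and "\<And>k. k < m \<Longrightarrow> f k 0 = 0"
    and "\<And>k. 1 \<le> k \<Longrightarrow> k < m \<Longrightarrow> deriv (f k) 0 = 1"
    and "\<And>k z. k < m \<Longrightarrow> z \<in> ball 0 1 \<Longrightarrow> norm (f k z) \<le> M k"
  shows "(\<forall>k<m. M k \<ge> 1) \<and>
         (\<not> (m = 1 \<and> M 0 = 1) \<longrightarrow>
            (\<exists>!r\<^sub>7. r\<^sub>7 \<in> {0<..<1} \<and> univalence_fun m M r\<^sub>7 = 0)) \<and>
         (\<forall>r\<^sub>7\<in>{0<..<1}. univalence_fun m M r\<^sub>7 = 0 \<longrightarrow>
            inj_on F (ball 0 r\<^sub>7) \<and>
            contains_schlicht_disk F (ball 0 r\<^sub>7) 0 (covering_radius m M r\<^sub>7))"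
proof -
  note m = assms(1) and hol = assms(3) and F_eq = assms(4) and f0 = assms(6) and bound = assms(8)
  have split_sum: "(\<Sum>k<m. u k) = u 0 + (\<Sum>k=1..<m. u k)" for u :: "nat \<Rightarrow> complex"
    using m by (simp add: lessThan_atLeast0 sum.atLeast_Suc_lessThan)

  have "deriv (f 0) 0 = 1"
  proof -
    have "(f 0 has_field_derivative deriv (f 0) 0) (at 0)"
      using hol[of 0] m by (metis centre_in_ball holomorphic_derivI less_le_trans open_ball zero_less_one)
    moreover have "((\<lambda>z. of_real (norm z ^ (2 * k)) * f k z) has_field_derivative 0) (at 0)"
      if "k \<in> {1..<m}" for k
      using that f0 bound by (intro norm_power_mult_has_derivative_zero) auto
    ultimately have "((\<lambda>z. f 0 z + (\<Sum>k=1..<m. of_real (norm z ^ (2 * k)) * f k z))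
        has_field_derivative deriv (f 0) 0 + (\<Sum>k=1..<m. 0)) (at 0)"
      by (intro DERIV_add DERIV_sum)
    then have "(F has_field_derivative deriv (f 0) 0 + (\<Sum>k=1..<m. 0)) (at 0)"
      by (rule has_field_derivative_transform_within_open[where S = "ball 0 1"])
        (auto simp: F_eq split_sum)
    then show ?thesis
      using wirtinger_z_eq_complex_deriv assms(5) by fastforce
  qed
  then have f1: "deriv (f k) 0 = 1" if "k < m" for k
    using that assms(7) by (cases "k = 0") auto
  have M1: "1 \<le> M k" if "k < m" for k
    using normalized_bounded_coeff(1)[OF hol f0 f1 bound] that by blast

  \<comment> \<open>Each \<open>f k z\<close> is split into \<open>z\<close> and the rest; the
    linear term for \<open>k = 0\<close> is the \<open>z\<close> on the left.\<close>
  have F_minus: "F z - z = (\<Sum>k<m. of_real (norm z ^ (2 * k)) * (f k z - z))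
      + (\<Sum>k=1..<m. of_real (norm z ^ (2 * k)) * z)" if "norm z < 1" for z
  proof -
    have "F z = (\<Sum>k<m. of_real (norm z ^ (2 * k)) * (f k z - z)) + (\<Sum>k<m. of_real (norm z ^ (2 * k)) * z)"
      using F_eq[of z] that by (simp add: algebra_simps sum_subtractf)
    also have "(\<Sum>k<m. of_real (norm z ^ (2 * k)) * z) = z + (\<Sum>k=1..<m. of_real (norm z ^ (2 * k)) * z)"
      by (subst split_sum) simp
    finally show ?thesis by simp
  qed

  have lipschitz: "norm ((F a - a) - (F b - b)) \<le> (1 - univalence_fun m M \<rho>) * norm (a - b)"
    if a: "norm a \<le> \<rho>" and b: "norm b \<le> \<rho>" and \<rho>: "\<rho> < 1" for a b \<rho>
  proof -
    \<comment> \<open>The power \<open>Suc 0\<close> fits the linear terms to the monomial estimate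
      with \<open>j = 0\<close>.\<close>
    have eq: "(F a - a) - (F b - b)
      = (\<Sum>k<m. of_real (norm a ^ (2 * k)) * (f k a - a) - of_real (norm b ^ (2 * k)) * (f k b - b))
      + (\<Sum>k=1..<m. of_real (norm a ^ (2 * k)) * a ^ Suc 0 - of_real (norm b ^ (2 * k)) * b ^ Suc 0)"
      using F_minus[of a] F_minus[of b] a b \<rho> by (simp add: sum_subtractf)
    have "norm ((F a - a) - (F b - b))
      \<le> (\<Sum>k<m. (M k - 1 / M k) * (((2 * real k * (1 - \<rho>) + (2 - \<rho>)) * \<rho> ^ (2 * k + 1)) / (1 - \<rho>)\<^sup>2) * norm (a - b))
      + (\<Sum>k=1..<m. (2 * real k + real (Suc 0)) * \<rho> ^ (2 * k + 0) * norm (a - b))"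
      unfolding eq
    proof (intro order_trans[OF norm_triangle_ineq] add_mono sum_norm_le)
      fix k assume "k \<in> {..<m}"
      then have k: "k < m" by simp
      show "norm (of_real (norm a ^ (2 * k)) * (f k a - a) - of_real (norm b ^ (2 * k)) * (f k b - b))
        \<le> (M k - 1 / M k) * (((2 * real k * (1 - \<rho>) + (2 - \<rho>)) * \<rho> ^ (2 * k + 1)) / (1 - \<rho>)\<^sup>2) * norm (a - b)"
        by (rule higher_terms_lipschitz[OF hol[OF k] f0[OF k] f1[OF k] bound[OF k] a b \<rho>])
    qed (rule norm_monomial_diff_le[OF a b])
    also have "\<dots> = (1 - univalence_fun m M \<rho>) * norm (a - b)"
      unfolding univalence_fun_def sum_distrib_right[symmetric] by (simp add: distrib_right)
    finally show ?thesis .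
  qed

  have lower: "covering_radius m M (norm z) \<le> norm (F z)" if z: "0 < norm z" "norm z < 1" for z
  proof -
    define r where "r = norm z"
    have "norm (F z - z) \<le> (\<Sum>k<m. (M k - 1 / M k) * (r ^ (2 * k + 2) / (1 - r))) + (\<Sum>k=1..<m. r ^ (2 * k + 1))"
      unfolding F_minus[OF z(2)]
    proof (intro order_trans[OF norm_triangle_ineq] add_mono sum_norm_le)
      fix k assume "k \<in> {..<m}"
      then have "norm (f k z - z) \<le> (M k - 1 / M k) * (r\<^sup>2 / (1 - r))"
        unfolding r_def using higher_terms_bound[OF hol f0 f1 bound z(2)] by auto
      then have "r ^ (2 * k) * norm (f k z - z) \<le> r ^ (2 * k) * ((M k - 1 / M k) * (r\<^sup>2 / (1 - r)))"
        by (intro mult_left_mono) (auto simp: r_def)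
      then show "norm (of_real (norm z ^ (2 * k)) * (f k z - z)) \<le> (M k - 1 / M k) * (r ^ (2 * k + 2) / (1 - r))"
        by (simp add: norm_mult norm_power r_def power_add power2_eq_square mult_ac)
    qed (simp add: norm_mult norm_power r_def)
    moreover have "norm z \<le> norm (F z) + norm (F z - z)"
      using norm_triangle_ineq4[of "F z" "F z - z"] by simp
    ultimately show ?thesis
      using covering_radius_eq_sum[OF m z, of M] by (simp add: r_def)
  qed

  have F0: "F 0 = 0"
    using F_eq[of 0] f0 by simp

  have "inj_on F (ball 0 r) \<and> contains_schlicht_disk F (ball 0 r) 0 (covering_radius m M r)"
    if r: "0 < r" "r < 1" and root: "univalence_fun m M r = 0" for r
  proof
    show inj: "inj_on F (ball 0 r)"
    proof (rule inj_onI)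
      fix a b
      assume ab: "a \<in> ball 0 r" "b \<in> ball 0 r" "F a = F b"
      \<comment> \<open>The maximum stays strictly below \<open>r\<close>, where
        \<open>univalence_fun\<close> is positive and the Lipschitz constant is below 1.\<close>
      define \<rho> where "\<rho> = max (norm a) (norm b)"
      have \<rho>: "norm a \<le> \<rho>" "norm b \<le> \<rho>" "0 \<le> \<rho>" "\<rho> < r"
        using ab by (auto simp: \<rho>_def le_max_iff_disj)
      have "norm (a - b) \<le> (1 - univalence_fun m M \<rho>) * norm (a - b)"
        using lipschitz[OF \<rho>(1,2)] \<rho> r ab by (simp add: norm_minus_commute)
      then have "univalence_fun m M \<rho> * norm (a - b) \<le> 0"
        by (simp add: algebra_simps)
      then show "a = b"
        using univalence_fun_pos_below_root[OF M1 \<rho>(3,4) r(2) root] by (simp add: mult_le_0_iff)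
    qed
    show "contains_schlicht_disk F (ball 0 r) 0 (covering_radius m M r)"
    proof (rule contains_schlicht_disk_of_sphere_bound[OF _ inj F0 r(1) covering_radius_pos[OF m M1 r root]])
      have "continuous_on (cball 0 r) (f k)" if "k < m" for k
        using holomorphic_on_imp_continuous_on[OF hol[OF that]] r by (auto elim: continuous_on_subset)
      then have "continuous_on (cball 0 r) (\<lambda>z. \<Sum>k<m. of_real (norm z ^ (2 * k)) * f k z)"
        by (intro continuous_intros) auto
      moreover have "F z = (\<Sum>k<m. of_real (norm z ^ (2 * k)) * f k z)" if "z \<in> cball 0 r" for z
        using that r by (intro F_eq) auto
      ultimately show "continuous_on (cball 0 r) F"
        using continuous_on_cong by (metis (no_types, lifting))
      show "covering_radius m M r \<le> norm (F z)" if "norm z = r" for z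
        using lower[of z] that r by simp
    qed
  qed
  then show ?thesis
    using M1 ex1_root_univalence_fun[OF m M1] by simp
qed

end
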